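(* Let $\{\xi(k),k\in\mathbb{Z}\}$ be a stationary sequence of random variables, independent of the random walk $\{S_n,n\in\mathbb{N}_+\}$, such that $n\,\mathbb{P}(\xi>u_n)\to\tau$ as $n\to\infty$, for some real sequence $(u_n)$ and some $\tau>0$. Assume that the condition $D(u_n)$ holds for the sequence $\{\xi(k),k\in\mathbb{Z}\}$, with $(\alpha_{n,l})$ and $(l_n)$ the associated families, and let $(k_n)$ be a sequence of integers with $k_n\to\infty$, $\frac{n^2}{k_n}\alpha_{n,l_n}\to0$, $k_nl_n=o(n)$; put $r_n=[n/k_n]$. Then for almost every realization of $\{S_n,n\in\mathbb{N}_+\}$, $$\mathbb{P}\left(M_{\mathcal{S}_n}\le u_n\right)-\exp\left(-\sum_{j\le K_n}\sum_{i=1}^{r_n}\mathbb{P}\left(\xi(S_{((j-1)r_n+i)})>u_n\ge M'_{((j-1)r_n+i+1,\,jr_n)}\right)\right)\longrightarrow0\quad\text{as }n\to\infty,$$ where the probabilities are taken with respect to the scenery $\xi$, the realization of the walk being fixed.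
   Context: Random walk: $\{X_k,k\in\mathbb{N}_+\}$ are i.i.d. integer-valued centered random variables (i.e. $\mathbb{E}X_1=0$ whenever the mean exists), $S_n=X_1+\cdots+X_n$, and $\mathbb{P}(S_n/n^{1/\alpha}\le x)\to F_\alpha(x)$ for every $x\in\mathbb{R}$, where $F_\alpha$ is the distribution function of the stable law with characteristic function $\phi(\theta)=\exp(-|\theta|^\alpha(C_1+iC_2\,\mathrm{sgn}\,\theta))$, $\alpha\in(0,2]$. $[\cdot]$ is the integer part. $\xi$ denotes a random variable with the law of $\xi(k)$; stationary means strictly stationary. Condition $D(u_n)$: with $F_{i_1,\ldots,i_p}(u)=\mathbb{P}(\xi(i_1)\le u,\ldots,\xi(i_p)\le u)$, there exist a family $(\alpha_{n,l})_{(n,l)\in\mathbb{N}^2}$ and a sequence $(l_n)$ of positive integers such that $\alpha_{n,l_n}\to0$, $l_n=o(n)$, and $|F_{i_1,\ldots,i_p,j_1,\ldots,j_{p'}}(u_n)-F_{i_1,\ldots,i_p}(u_n)F_{j_1,\ldots,j_{p'}}(u_n)|\le\alpha_{n,l}$ for all integers $i_1<\cdots<i_p<j_1<\cdots<j_{p'}$ with $j_1-i_p\ge l$ (uniformly in $p,p'$). Notation: $\mathcal{S}_n=\{S_1,\ldots,S_n\}$ is the set of visited sites, $R_n=\#\mathcal{S}_n$, and $S_{(1)}<S_{(2)}<\cdots<S_{(R_n)}$ are the elements of $\mathcal{S}_n$ in increasing order (they depend on $n$). $M_{\mathcal{S}_n}=\max_{k\in\mathcal{S}_n}\xi(k)$.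 $M'_{(i,j)}=\max_{i\le t\le j}\xi(S_{(t)})$ if $i\le j$ and $M'_{(i,j)}=-\infty$ if $i>j$. $K_n=[R_n/r_n]+1$ is the number of blocks of $r_n$ consecutive elements into which $\mathcal{S}_n$ is split; for the last, possibly shorter, block, terms and indices exceeding $R_n$ are omitted (in the double sum and in the maximum $M'$). *)

theory Defs
  imports "HOL-Probability.Probability" "HOL-Library.Landau_Symbols"
begin

definition stable_cf :: "real \<Rightarrow> real \<Rightarrow> real \<Rightarrow> real \<Rightarrow> complex" where
  "stable_cf \<alpha> C\<^sub>1 C\<^sub>2 \<theta> =
     exp (- (of_real (\<bar>\<theta>\<bar> powr \<alpha>) * (of_real C\<^sub>1 + \<i> * of_real C\<^sub>2 * of_real (sgn \<theta>))))"

text \<open>The steps are \<open>X 1, X 2, \<dots>\<close>; the value \<open>X 0\<close> is never used.\<close>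

definition walk :: "(nat \<Rightarrow> 'a \<Rightarrow> int) \<Rightarrow> nat \<Rightarrow> 'a \<Rightarrow> int" where
  "walk X n \<omega> = (\<Sum>k=1..n. X k \<omega>)"

definition visited :: "(nat \<Rightarrow> 'a \<Rightarrow> int) \<Rightarrow> nat \<Rightarrow> 'a \<Rightarrow> int set" where
  "visited X n \<omega> = (\<lambda>k. walk X k \<omega>) ` {1..n}"

definition range_size :: "(nat \<Rightarrow> 'a \<Rightarrow> int) \<Rightarrow> nat \<Rightarrow> 'a \<Rightarrow> nat" where
  "range_size X n \<omega> = card (visited X n \<omega>)"

text \<open>The \<open>t\<close>-th smallest visited site, meaningful for \<open>1 \<le> t \<le> range_size X n \<omega>\<close>.\<close>

definition ordered_site :: "(nat \<Rightarrow> 'a \<Rightarrow> int) \<Rightarrow> nat \<Rightarrow> 'a \<Rightarrow> nat \<Rightarrow> int" where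
  "ordered_site X n \<omega> t = sorted_list_of_set (visited X n \<omega>) ! (t - 1)"

definition strictly_stationary :: "'a measure \<Rightarrow> (int \<Rightarrow> 'a \<Rightarrow> real) \<Rightarrow> bool" where
  "strictly_stationary M \<xi> \<longleftrightarrow>
     (\<forall>J h. finite J \<longrightarrow>
        distr M (PiM J (\<lambda>_. borel)) (\<lambda>\<omega>. \<lambda>k\<in>J. \<xi> (k + h) \<omega>) =
        distr M (PiM J (\<lambda>_. borel)) (\<lambda>\<omega>. \<lambda>k\<in>J. \<xi> k \<omega>))"

text \<open>The library's \<open>indep_var\<close> needs both random elements to have the same value type; the walk and
  the scenery do not.\<close>

definition indep_elements ::
  "'a measure \<Rightarrow> 'b measure \<Rightarrow> ('a \<Rightarrow> 'b) \<Rightarrow> 'c measure \<Rightarrow> ('a \<Rightarrow> 'c) \<Rightarrow> bool" where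
  "indep_elements M A f B g \<longleftrightarrow>
     f \<in> measurable M A \<and> g \<in> measurable M B \<and>
     prob_space.indep_set M
       (sets (vimage_algebra (space M) f A)) (sets (vimage_algebra (space M) g B))"

text \<open>An increasing tuple of indices is represented by the finite set of its entries.\<close>

definition joint_cdf :: "'a measure \<Rightarrow> (int \<Rightarrow> 'a \<Rightarrow> real) \<Rightarrow> int set \<Rightarrow> real \<Rightarrow> real" where
  "joint_cdf M \<xi> I v = \<P>(\<omega> in M. \<forall>i\<in>I. \<xi> i \<omega> \<le> v)"

definition condition_D ::
  "'a measure \<Rightarrow> (int \<Rightarrow> 'a \<Rightarrow> real) \<Rightarrow> (nat \<Rightarrow> real) \<Rightarrow> (nat \<Rightarrow> nat \<Rightarrow> real) \<Rightarrow> (nat \<Rightarrow> nat) \<Rightarrow> bool" where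
  "condition_D M \<xi> u a l \<longleftrightarrow>
     (\<forall>n. 0 < l n) \<and>
     (\<lambda>n. a n (l n)) \<longlonglongrightarrow> 0 \<and>
     (\<lambda>n. real (l n)) \<in> o(\<lambda>n. real n) \<and>
     (\<forall>n m I J. finite I \<and> I \<noteq> {} \<and> finite J \<and> J \<noteq> {} \<and>
        Max I < Min J \<and> Min J - Max I \<ge> int m \<longrightarrow>
        \<bar>joint_cdf M \<xi> (I \<union> J) (u n) - joint_cdf M \<xi> I (u n) * joint_cdf M \<xi> J (u n)\<bar> \<le> a n m)"

text \<open>In the next two definitions \<open>\<omega>\<close> is the realization of the walk, kept fixed, and
  \<open>\<omega>'\<close> that of the scenery.\<close>

definition visited_max :: "(int \<Rightarrow> 'a \<Rightarrow> real) \<Rightarrow> (nat \<Rightarrow> 'a \<Rightarrow> int) \<Rightarrow> nat \<Rightarrow> 'a \<Rightarrow> 'a \<Rightarrow> real" where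
  "visited_max \<xi> X n \<omega> \<omega>' = Max ((\<lambda>k. \<xi> k \<omega>') ` visited X n \<omega>)"

definition segment_max ::
  "(int \<Rightarrow> 'a \<Rightarrow> real) \<Rightarrow> (nat \<Rightarrow> 'a \<Rightarrow> int) \<Rightarrow> nat \<Rightarrow> 'a \<Rightarrow> nat \<Rightarrow> nat \<Rightarrow> 'a \<Rightarrow> ereal" where
  "segment_max \<xi> X n \<omega> i j \<omega>' =
     (if i \<le> j then Max ((\<lambda>t. ereal (\<xi> (ordered_site X n \<omega> t) \<omega>')) ` {i..j}) else - \<infinity>)"

text \<open>The double sum in the exponent, with block length \<open>r\<close> and \<open>R div r + 1\<close> blocks. Positions
  beyond the number \<open>R\<close> of visited sites, which can occur only in the last block, are left out.\<close>

definition last_exceedance_sum ::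
  "'a measure \<Rightarrow> (int \<Rightarrow> 'a \<Rightarrow> real) \<Rightarrow> (nat \<Rightarrow> 'a \<Rightarrow> int) \<Rightarrow> real \<Rightarrow> nat \<Rightarrow> nat \<Rightarrow> 'a \<Rightarrow> real" where
  "last_exceedance_sum M \<xi> X v r n \<omega> =
     (let R = range_size X n \<omega> in
      \<Sum>j = 1..R div r + 1. \<Sum>i \<in> {i \<in> {1..r}. (j - 1) * r + i \<le> R}.
        \<P>(\<omega>' in M. \<xi> (ordered_site X n \<omega> ((j - 1) * r + i)) \<omega>' > v \<and>
          ereal v \<ge> segment_max \<xi> X n \<omega> ((j - 1) * r + i + 1) (min (j * r) R) \<omega>'))"

end

theory Submission
  imports Defs
begin

text \<open>
  The conclusion holds for every realization of the walk. Once the walk is fixed, its range is a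
  finite set of \<open>R \<le> n\<close> integers, and the convergence follows from an error bound that sees
  this set only through \<open>R\<close>.

  Write \<open>q = P(\<xi> > u\<^sub>n)\<close>, and let \<open>p\<^sub>j\<close> be the probability that the maximum of the scenery over
  the \<open>j\<close>-th block of visited sites exceeds \<open>u\<^sub>n\<close>. A block has an exceedance iff it has a last one,
  so the inner sums of the exponent are exactly the \<open>p\<^sub>j\<close> (\<open>sum_last_exceedance\<close>,
  \<open>last_exceedance_sum_eq\<close>), and it remains to compare \<open>P(M \<le> u\<^sub>n)\<close> with the product of the
  \<open>exp (- p\<^sub>j)\<close>. This is the classical block argument for maxima, run along the ordered
  visited sites instead of along consecutive integers:

  \<^item> Deleting the last \<open>l\<close> sites of each of the \<open>K\<close> blocks changes the probability by at most \<open>K l q\<close>.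
    Because the sites are distinct integers in increasing order, the trimmed blocks lie at distance at
    least \<open>l\<close> from each other: sparsity of the range only helps.
  \<^item> By the mixing condition, factorizing over the trimmed blocks costs at most \<open>K a\<close>
    (\<open>joint_cdf_UN_product\<close>).
  \<^item> Each factor differs from \<open>1 - p\<^sub>j\<close> by at most \<open>l q\<close>, and \<open>1 - p\<^sub>j\<close> differs from \<open>exp (- p\<^sub>j)\<close> by
    at most \<open>p\<^sub>j\<^sup>2 \<le> (r q)\<^sup>2\<close>.

  Together (\<open>joint_cdf_block_approx\<close>) the error is at most \<open>K (2 l q + a + (r q)\<^sup>2)\<close>. Since
  \<open>K \<le> 2 k\<close> and \<open>r \<le> n / k\<close> for large \<open>n\<close> (\<open>block_count_bound\<close>), and \<open>n q\<close> converges, the three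
  terms are of the order of \<open>k l / n\<close>, of \<open>k a \<le> n\<^sup>2 a / k\<close> and of \<open>1 / k\<close>, and all tend to zero.
\<close>

section \<open>Joint distribution functions of the scenery at a fixed level\<close>

lemma (in prob_space) joint_cdf_bounds: "0 \<le> joint_cdf M \<xi> I v" "joint_cdf M \<xi> I v \<le> 1"
  by (simp_all add: joint_cdf_def)

lemma (in prob_space) joint_cdf_empty: "joint_cdf M \<xi> {} v = 1"
  by (simp add: joint_cdf_def prob_space)

text \<open>A union bound: forgetting a site can only matter if that site exceeds the level.\<close>

lemma (in prob_space) joint_cdf_removal:
  assumes meas: "\<And>i. \<xi> i \<in> borel_measurable M"
    and "finite I" and "J \<subseteq> I"
    and marginal: "\<And>i. prob {\<omega> \<in> space M. \<xi> i \<omega> > v} = q"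
  shows "\<bar>joint_cdf M \<xi> I v - joint_cdf M \<xi> J v\<bar> \<le> real (card (I - J)) * q"
proof -
  note [measurable] = meas
  have fin: "finite J" "finite (I - J)" using assms by (auto intro: finite_subset)
  let ?A = "{\<omega> \<in> space M. \<forall>i\<in>I. \<xi> i \<omega> \<le> v}" and ?B = "{\<omega> \<in> space M. \<forall>i\<in>J. \<xi> i \<omega> \<le> v}"
  let ?E = "\<lambda>i. {\<omega> \<in> space M. \<xi> i \<omega> > v}"
  have A: "?A \<in> events" and B: "?B \<in> events" using \<open>finite I\<close> fin by measurable
  have E: "?E i \<in> events" for i by measurable
  have U: "(\<Union>i\<in>I - J. ?E i) \<in> events" using fin E by (intro sets.finite_UN) auto
  have "?B \<subseteq> ?A \<union> (\<Union>i\<in>I - J. ?E i)" by force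
  then have "prob ?B \<le> prob (?A \<union> (\<Union>i\<in>I - J. ?E i))"
    using A U by (intro finite_measure_mono) auto
  also have "\<dots> \<le> prob ?A + prob (\<Union>i\<in>I - J. ?E i)"
    by (rule measure_Un_le[OF A U])
  also have "prob (\<Union>i\<in>I - J. ?E i) \<le> (\<Sum>i\<in>I - J. prob (?E i))"
    using fin E by (intro finite_measure_subadditive_finite) auto
  also have "\<dots> = real (card (I - J)) * q" by (simp add: marginal)
  finally have "prob ?B \<le> prob ?A + real (card (I - J)) * q" by simp
  moreover have "prob ?A \<le> prob ?B"
    using \<open>J \<subseteq> I\<close> B by (intro finite_measure_mono) auto
  ultimately show ?thesis by (simp add: joint_cdf_def)
qed

lemma (in prob_space) stationary_marginal:
  assumes stat: "strictly_stationary M \<xi>" and meas: "\<And>i. \<xi> i \<in> borel_measurable M"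
  shows "prob {\<omega> \<in> space M. \<xi> i \<omega> > v} = prob {\<omega> \<in> space M. \<xi> 0 \<omega> > v}"
proof -
  note [measurable] = meas
  let ?P = "PiM {0::int} (\<lambda>_. borel :: real measure)"
  let ?A = "{f \<in> space ?P. f 0 > v}"
  have A: "?A \<in> sets ?P" by measurable
  have shifted: "measure (distr M ?P (\<lambda>\<omega>. \<lambda>k\<in>{0}. \<xi> (k + h) \<omega>)) ?A
      = prob {\<omega> \<in> space M. \<xi> h \<omega> > v}" for h
  proof -
    have "(\<lambda>\<omega>. \<lambda>k\<in>{0}. \<xi> (k + h) \<omega>) \<in> measurable M ?P" by measurable
    then show ?thesis
      using A by (subst measure_distr) (auto intro!: arg_cong[where f = prob] simp: space_PiM)
  qed
  have "distr M ?P (\<lambda>\<omega>. \<lambda>k\<in>{0}. \<xi> (k + i) \<omega>) = distr M ?P (\<lambda>\<omega>. \<lambda>k\<in>{0}. \<xi> k \<omega>)"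
    by (rule stat[unfolded strictly_stationary_def, rule_format]) simp
  then show ?thesis using shifted[of i] shifted[of 0] by simp
qed

text \<open>Condition \<open>D\<close> in the form needed for trimmed blocks: a short last block may become empty, and
  an empty set has no \<open>Max\<close> or \<open>Min\<close> to compare. Then the left-hand side vanishes, and the bound is
  nonnegative because it dominates an absolute value for some pair of singletons.\<close>

lemma (in prob_space) mixing_gap:
  assumes D: "condition_D M \<xi> u a l"
    and "finite I" "finite J"
    and gap: "\<And>i j. i \<in> I \<Longrightarrow> j \<in> J \<Longrightarrow> i < j \<and> int m \<le> j - i"
  shows "\<bar>joint_cdf M \<xi> (I \<union> J) (u n) - joint_cdf M \<xi> I (u n) * joint_cdf M \<xi> J (u n)\<bar> \<le> a n m"
proof -
  have mix: "\<bar>joint_cdf M \<xi> (I \<union> J) (u n) - joint_cdf M \<xi> I (u n) * joint_cdf M \<xi> J (u n)\<bar> \<le> a n m"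
    if "finite I" "I \<noteq> {}" "finite J" "J \<noteq> {}" "Max I < Min J" "Min J - Max I \<ge> int m" for I J
    using D that unfolding condition_D_def by blast
  show ?thesis
  proof (cases "I = {} \<or> J = {}")
    case True
    have "0 \<le> a n m" using mix[of "{0}" "{int m + 1}"] by simp
    then show ?thesis using True by (auto simp: joint_cdf_empty)
  next
    case False
    then show ?thesis using mix[of I J] gap[of "Max I" "Min J"] assms(2,3) by auto
  qed
qed

section \<open>Asymptotic independence over blocks\<close>

text \<open>The mixing error of splitting off one block is not amplified later on, as the remaining
  factors are probabilities; so the errors add up linearly in the number of blocks.\<close>

lemma (in prob_space) joint_cdf_UN_product:
  assumes fin: "\<And>j. finite (B j)"
    and mix: "\<And>I J. finite I \<Longrightarrow> finite J \<Longrightarrow>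
        (\<And>i j. i \<in> I \<Longrightarrow> j \<in> J \<Longrightarrow> i < j \<and> int m \<le> j - i) \<Longrightarrow>
        \<bar>joint_cdf M \<xi> (I \<union> J) v - joint_cdf M \<xi> I v * joint_cdf M \<xi> J v\<bar> \<le> \<delta>"
    and gap: "\<And>i j x y. 1 \<le> i \<Longrightarrow> i < j \<Longrightarrow> x \<in> B i \<Longrightarrow> y \<in> B j \<Longrightarrow> x < y \<and> int m \<le> y - x"
  shows "\<bar>joint_cdf M \<xi> (\<Union>j\<in>{1..K}. B j) v - (\<Prod>j=1..K. joint_cdf M \<xi> (B j) v)\<bar> \<le> real K * \<delta>"
proof (induction K)
  case 0
  show ?case by (simp add: joint_cdf_empty)
next
  case (Suc K)
  let ?U = "\<Union>j\<in>{1..K}. B j" and ?g = "\<lambda>I. joint_cdf M \<xi> I v"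
  let ?p = "\<Prod>j=1..K. ?g (B j)"
  have "\<bar>?g (?U \<union> B (Suc K)) - ?g ?U * ?g (B (Suc K))\<bar> \<le> \<delta>"
  proof (rule mix)
    fix x y assume "x \<in> ?U" "y \<in> B (Suc K)"
    then obtain i where "1 \<le> i" "i < Suc K" "x \<in> B i" by auto
    then show "x < y \<and> int m \<le> y - x" using gap \<open>y \<in> B (Suc K)\<close> by blast
  qed (use fin in auto)
  moreover have "\<bar>?g ?U * ?g (B (Suc K)) - ?p * ?g (B (Suc K))\<bar> \<le> real K * \<delta>"
  proof -
    have "\<bar>?g ?U * ?g (B (Suc K)) - ?p * ?g (B (Suc K))\<bar> = \<bar>?g ?U - ?p\<bar> * ?g (B (Suc K))"
      using joint_cdf_bounds(1) by (simp add: abs_mult flip: left_diff_distrib)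
    also have "\<dots> \<le> \<bar>?g ?U - ?p\<bar> * 1"
      by (intro mult_left_mono joint_cdf_bounds) auto
    finally show ?thesis using Suc.IH by simp
  qed
  moreover have "(\<Union>j\<in>{1..Suc K}. B j) = ?U \<union> B (Suc K)"
    by (auto simp: atLeastAtMostSuc_conv)
  ultimately show ?case by (simp add: algebra_simps)
qed

lemma exp_minus_close:
  fixes p :: real
  assumes "0 \<le> p"
  shows "\<bar>1 - p - exp (- p)\<bar> \<le> p\<^sup>2"
proof -
  have "exp (- p) \<le> 1 / (1 + p)"
    using exp_ge_add_one_self[of p] assms by (simp add: exp_minus field_simps)
  also have "\<dots> \<le> 1 - p + p\<^sup>2"
  proof -
    have "(1 - p + p\<^sup>2) * (1 + p) = 1 + p ^ 3"
      by (simp add: algebra_simps power2_eq_square power3_eq_cube)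
    then show ?thesis using assms by (simp add: divide_le_eq)
  qed
  finally show ?thesis using exp_ge_add_one_self[of "- p"] by simp
qed

definition block :: "nat \<Rightarrow> nat \<Rightarrow> nat \<Rightarrow> nat set" where
  "block r R j = {(j - 1) * r + 1..min (j * r) R}"

definition trimmed_block :: "nat \<Rightarrow> nat \<Rightarrow> nat \<Rightarrow> nat \<Rightarrow> nat set" where
  "trimmed_block m r R j = {t \<in> block r R j. t + m \<le> min (j * r) R}"

lemma finite_block: "finite (block r R j)"
  by (simp add: block_def)

lemma trimmed_block_subset: "trimmed_block m r R j \<subseteq> block r R j"
  by (auto simp: trimmed_block_def)

lemma finite_trimmed_block: "finite (trimmed_block m r R j)"
  using finite_subset[OF trimmed_block_subset finite_block] .

lemma block_subset: "block r R j \<subseteq> {1..R}"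
  by (auto simp: block_def)

lemma card_block_le:
  assumes "1 \<le> j"
  shows "card (block r R j) \<le> r"
proof -
  have "j * r = (j - 1) * r + r" using assms by (cases j) auto
  then show ?thesis by (simp add: block_def)
qed

lemma card_block_removed_le: "card (block r R j - trimmed_block m r R j) \<le> m"
proof -
  have "block r R j - trimmed_block m r R j \<subseteq> {min (j * r) R + 1 - m..<min (j * r) R + 1}"
    by (auto simp: block_def trimmed_block_def)
  then have "card (block r R j - trimmed_block m r R j)
      \<le> card {min (j * r) R + 1 - m..<min (j * r) R + 1}"
    by (intro card_mono) auto
  also have "\<dots> \<le> m" by simp
  finally show ?thesis .
qed

lemma UN_block:
  assumes "0 < r"
  shows "(\<Union>j\<in>{1..R div r + 1}. block r R j) = {1..R}"
proof (intro equalityI subsetI)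
  fix t assume t: "t \<in> {1..R}"
  let ?j = "(t - 1) div r + 1"
  have "(t - 1) div r * r \<le> t - 1" by (rule div_times_less_eq_dividend)
  then have "(t - 1) div r * r + 1 \<le> t" using t by (simp only: atLeastAtMost_iff) linarith
  moreover have "t - 1 < ((t - 1) div r + 1) * r"
    using assms dividend_less_div_times[of r "t - 1"] by (simp add: algebra_simps)
  moreover have "?j \<le> R div r + 1" using t by (auto intro!: div_le_mono)
  ultimately show "t \<in> (\<Union>j\<in>{1..R div r + 1}. block r R j)"
    using t by (intro UN_I[of ?j]) (auto simp: block_def)
qed (use block_subset in blast)

text \<open>Trimming at the right end \<open>min (j * r) R\<close> makes a gap after each block, whether or not
  \<open>m\<close> exceeds the length of a block (which is then trimmed to the empty set).\<close>

lemma trimmed_block_gap: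
  assumes "i < j" "t \<in> trimmed_block m r R i" "t' \<in> trimmed_block m r R j"
  shows "t + m < t'"
proof -
  have "i * r \<le> (j - 1) * r" using assms(1) by (intro mult_right_mono) auto
  moreover have "t + m \<le> i * r" "(j - 1) * r + 1 \<le> t'"
    using assms(2,3) by (simp_all add: trimmed_block_def block_def)
  ultimately show ?thesis by linarith
qed

text \<open>A gap between positions in the ordered range is at least as large between the sites themselves;
  this is where integrality of the walk enters.\<close>

lemma int_strict_mono_on_gap:
  fixes s :: "nat \<Rightarrow> int"
  assumes "strict_mono_on {1..R} s" "1 \<le> t" "t \<le> t'" "t' \<le> R"
  shows "int (t' - t) \<le> s t' - s t"
  using assms(3,4)
proof (induction rule: dec_induct)
  case (step n)
  have "s n < s (Suc n)"
    using assms(1,2) step by (intro strict_mono_onD[of "{1..R}" s]) auto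
  then show ?case using step by (auto simp: Suc_diff_le)
qed simp

text \<open>The quantitative form of the theorem, for an arbitrary increasing family of sites. The two terms
  \<open>m * q\<close> come from trimming twice: once for the whole set, and once when each factor is
  replaced by that of its full block.\<close>

lemma (in prob_space) joint_cdf_block_approx:
  fixes s :: "nat \<Rightarrow> int"
  assumes meas: "\<And>i. \<xi> i \<in> borel_measurable M"
    and marginal: "\<And>i. prob {\<omega> \<in> space M. \<xi> i \<omega> > v} = q"
    and mix: "\<And>I J. finite I \<Longrightarrow> finite J \<Longrightarrow>
        (\<And>i j. i \<in> I \<Longrightarrow> j \<in> J \<Longrightarrow> i < j \<and> int m \<le> j - i) \<Longrightarrow>
        \<bar>joint_cdf M \<xi> (I \<union> J) v - joint_cdf M \<xi> I v * joint_cdf M \<xi> J v\<bar> \<le> \<delta>"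
    and mono: "strict_mono_on {1..R} s"
    and "0 < r"
  shows "\<bar>joint_cdf M \<xi> (s ` {1..R}) v
        - exp (- (\<Sum>j=1..R div r + 1. 1 - joint_cdf M \<xi> (s ` block r R j) v))\<bar>
      \<le> real (R div r + 1) * (2 * (real m * q) + \<delta> + (real r * q)\<^sup>2)"
proof -
  define K where "K = R div r + 1"
  define g where "g I = joint_cdf M \<xi> I v" for I
  define B where "B j = s ` block r R j" for j
  define T where "T j = s ` trimmed_block m r R j" for j
  have q: "0 \<le> q" using marginal[of 0] by (metis measure_nonneg)
  have fin: "finite (B j)" "finite (T j)" for j
    by (auto simp: B_def T_def finite_block finite_trimmed_block)
  have sub: "T j \<subseteq> B j" for j
    unfolding B_def T_def by (intro image_mono trimmed_block_subset)
  have removed: "card (B j - T j) \<le> m" for j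
  proof -
    have "B j - T j \<subseteq> s ` (block r R j - trimmed_block m r R j)"
      by (auto simp: B_def T_def)
    then have "card (B j - T j) \<le> card (block r R j - trimmed_block m r R j)"
      by (meson card_image_le card_mono finite_Diff finite_block finite_imageI le_trans)
    then show ?thesis using card_block_removed_le le_trans by blast
  qed
  have all: "s ` {1..R} = (\<Union>j\<in>{1..K}. B j)"
    using arg_cong[where f = "image s", OF UN_block[OF \<open>0 < r\<close>, of R]]
    unfolding K_def B_def by (simp only: image_UN)

  have "\<bar>g (\<Union>j\<in>{1..K}. B j) - g (\<Union>j\<in>{1..K}. T j)\<bar>
      \<le> real (card ((\<Union>j\<in>{1..K}. B j) - (\<Union>j\<in>{1..K}. T j))) * q"
    unfolding g_def
    by (rule joint_cdf_removal[OF meas _ _ marginal]) (use fin sub in blast)+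
  also have "\<dots> \<le> real (K * m) * q"
  proof (intro mult_right_mono q of_nat_mono)
    have "card ((\<Union>j\<in>{1..K}. B j) - (\<Union>j\<in>{1..K}. T j)) \<le> card (\<Union>j\<in>{1..K}. B j - T j)"
      using fin by (intro card_mono) auto
    also have "\<dots> \<le> (\<Sum>j\<in>{1..K}. card (B j - T j))" by (rule card_UN_le) simp
    also have "\<dots> \<le> K * m"
      using sum_bounded_above[of "{1..K}" "\<lambda>j. card (B j - T j)" m] removed by simp
    finally show "card ((\<Union>j\<in>{1..K}. B j) - (\<Union>j\<in>{1..K}. T j)) \<le> K * m" .
  qed
  finally have trim: "\<bar>g (\<Union>j\<in>{1..K}. B j) - g (\<Union>j\<in>{1..K}. T j)\<bar> \<le> real K * (real m * q)"
    by (simp add: mult_ac)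

  have prod: "\<bar>g (\<Union>j\<in>{1..K}. T j) - (\<Prod>j=1..K. g (T j))\<bar> \<le> real K * \<delta>"
    unfolding g_def
  proof (rule joint_cdf_UN_product[OF fin(2) mix])
    fix i j x y
    assume "1 \<le> i" "i < j" "x \<in> T i" "y \<in> T j"
    then obtain t t' where t: "t \<in> trimmed_block m r R i" "x = s t"
        "t' \<in> trimmed_block m r R j" "y = s t'"
      by (auto simp: T_def)
    have range: "1 \<le> t" "t' \<le> R"
      using t trimmed_block_subset block_subset by (meson atLeastAtMost_iff subsetD)+
    have "t + m < t'" using trimmed_block_gap[OF \<open>i < j\<close> t(1,3)] .
    then show "x < y \<and> int m \<le> y - x"
      using int_strict_mono_on_gap[OF mono range(1) _ range(2)] t by fastforce
  qed

  have factor: "\<bar>g (T j) - exp (- (1 - g (B j)))\<bar> \<le> real m * q + (real r * q)\<^sup>2"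
    if "j \<in> {1..K}" for j
  proof -
    have "\<bar>g (B j) - g (T j)\<bar> \<le> real (card (B j - T j)) * q"
      unfolding g_def by (rule joint_cdf_removal[OF meas fin(1) sub marginal])
    also have "\<dots> \<le> real m * q" using removed q by (intro mult_right_mono) auto
    finally have BT: "\<bar>g (B j) - g (T j)\<bar> \<le> real m * q" .
    have "\<bar>g (B j) - g {}\<bar> \<le> real (card (B j - {})) * q"
      unfolding g_def by (rule joint_cdf_removal[OF meas fin(1) _ marginal]) simp
    also have "\<dots> \<le> real r * q"
      using card_block_le[of j r R] card_image_le[OF finite_block, of s r R j] q that
      by (intro mult_right_mono) (auto simp: B_def)
    finally have "1 - g (B j) \<le> real r * q" by (simp add: g_def joint_cdf_empty)
    moreover have "0 \<le> 1 - g (B j)" using joint_cdf_bounds(2) by (simp add: g_def)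
    ultimately have "(1 - g (B j))\<^sup>2 \<le> (real r * q)\<^sup>2" by (intro power_mono)
    moreover have "\<bar>g (B j) - exp (- (1 - g (B j)))\<bar> \<le> (1 - g (B j))\<^sup>2"
      using exp_minus_close[OF \<open>0 \<le> 1 - g (B j)\<close>] by simp
    ultimately show ?thesis using BT by linarith
  qed
  \<comment> \<open>Factors in the unit interval: the difference of products is at most the sum of differences.\<close>
  have "\<bar>(\<Prod>j=1..K. g (T j)) - (\<Prod>j=1..K. exp (- (1 - g (B j))))\<bar>
      \<le> (\<Sum>j=1..K. \<bar>g (T j) - exp (- (1 - g (B j)))\<bar>)"
    using norm_prod_diff[of "{1..K}" "\<lambda>j. g (T j)" "\<lambda>j. exp (- (1 - g (B j)))"]
    by (simp add: g_def joint_cdf_bounds)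
  also have "\<dots> \<le> real K * (real m * q + (real r * q)\<^sup>2)"
    using sum_bounded_above[of "{1..K}", OF factor] by simp
  finally have expo: "\<bar>(\<Prod>j=1..K. g (T j)) - exp (- (\<Sum>j=1..K. 1 - g (B j)))\<bar>
      \<le> real K * (real m * q + (real r * q)\<^sup>2)"
    by (simp only: exp_sum[symmetric] finite_atLeastAtMost sum_negf)
  have "\<bar>g (s ` {1..R}) - exp (- (\<Sum>j=1..K. 1 - g (B j)))\<bar>
      \<le> real K * (2 * (real m * q) + \<delta> + (real r * q)\<^sup>2)"
    unfolding all using trim prod expo by (simp add: distrib_left)
  then show ?thesis by (simp only: K_def g_def B_def)
qed

section \<open>Last exceedances\<close>

text \<open>The event that some \<open>Y t\<close> exceeds \<open>v\<close> splits disjointly according to the position of the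
  last exceedance.\<close>

lemma (in prob_space) sum_last_exceedance:
  fixes Y :: "nat \<Rightarrow> 'a \<Rightarrow> real"
  assumes meas: "\<And>t. Y t \<in> borel_measurable M"
  shows "(\<Sum>t=p..e. prob {\<omega> \<in> space M. Y t \<omega> > v \<and> (\<forall>t'\<in>{t + 1..e}. Y t' \<omega> \<le> v)})
    = 1 - prob {\<omega> \<in> space M. \<forall>t\<in>{p..e}. Y t \<omega> \<le> v}"
proof -
  note [measurable] = meas
  let ?L = "\<lambda>t. {\<omega> \<in> space M. Y t \<omega> > v \<and> (\<forall>t'\<in>{t + 1..e}. Y t' \<omega> \<le> v)}"
  let ?A = "{\<omega> \<in> space M. \<forall>t\<in>{p..e}. Y t \<omega> \<le> v}"
  have A: "?A \<in> events" by measurable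
  have L: "?L t \<in> events" for t by measurable
  have disj: "disjoint_family_on ?L {p..e}"
    unfolding disjoint_family_on_def
  proof (intro ballI impI equals0I)
    fix t t' \<omega> assume t: "t \<in> {p..e}" "t' \<in> {p..e}" "t \<noteq> t'" and \<omega>: "\<omega> \<in> ?L t \<inter> ?L t'"
    from t(3) have "t' \<in> {t + 1..e} \<or> t \<in> {t' + 1..e}" using t(1,2) by auto
    moreover have "v < Y t \<omega>" "v < Y t' \<omega>" using \<omega> by auto
    ultimately show False using \<omega> by (auto simp: not_le[symmetric])
  qed
  have "(\<Union>t\<in>{p..e}. ?L t) = space M - ?A"
  proof (intro equalityI subsetI)
    fix \<omega> assume \<omega>: "\<omega> \<in> space M - ?A"
    let ?E = "{t \<in> {p..e}. Y t \<omega> > v}"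
    obtain t where "t \<in> {p..e}" "v < Y t \<omega>" using \<omega> not_le by blast
    then have ne: "finite ?E" "?E \<noteq> {}" by auto
    then have "Max ?E \<in> ?E" by (rule Max_in)
    moreover have "Y t' \<omega> \<le> v" if "t' \<in> {Max ?E + 1..e}" for t'
    proof (rule ccontr)
      assume "\<not> Y t' \<omega> \<le> v"
      then have "t' \<in> ?E" using that \<open>Max ?E \<in> ?E\<close> by auto
      then have "t' \<le> Max ?E" using ne by (intro Max_ge)
      then show False using that by simp
    qed
    ultimately show "\<omega> \<in> (\<Union>t\<in>{p..e}. ?L t)" using \<omega> by blast
  next
    fix \<omega> assume "\<omega> \<in> (\<Union>t\<in>{p..e}. ?L t)"
    then obtain t where "t \<in> {p..e}" "\<omega> \<in> space M" "v < Y t \<omega>" by blast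
    then show "\<omega> \<in> space M - ?A" using leD by blast
  qed
  then have "1 - prob ?A = prob (\<Union>t\<in>{p..e}. ?L t)" by (simp add: prob_compl[OF A])
  also have "\<dots> = (\<Sum>t=p..e. prob (?L t))"
    using L disj by (intro finite_measure_finite_Union) auto
  finally show ?thesis by simp
qed

lemma segment_max_le_iff:
  "segment_max \<xi> X n \<omega> i j \<omega>' \<le> ereal v \<longleftrightarrow> (\<forall>t\<in>{i..j}. \<xi> (ordered_site X n \<omega> t) \<omega>' \<le> v)"
  by (auto simp: segment_max_def)

lemma visited_max_le_iff:
  assumes "0 < n"
  shows "visited_max \<xi> X n \<omega> \<omega>' \<le> v \<longleftrightarrow> (\<forall>i\<in>visited X n \<omega>. \<xi> i \<omega>' \<le> v)"
  using assms unfolding visited_max_def by (subst Max_le_iff) (auto simp: visited_def)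

lemma ordered_site_image: "ordered_site X n \<omega> ` {1..range_size X n \<omega>} = visited X n \<omega>"
proof -
  let ?xs = "sorted_list_of_set (visited X n \<omega>)"
  have "finite (visited X n \<omega>)" by (simp add: visited_def)
  then have set: "set ?xs = visited X n \<omega>" and len: "length ?xs = range_size X n \<omega>"
    by (simp_all add: range_size_def)
  have "ordered_site X n \<omega> ` {1..range_size X n \<omega>} = (\<lambda>t. ?xs ! t) ` {..<length ?xs}"
    unfolding len
  proof (intro equalityI subsetI)
    fix x assume "x \<in> (\<lambda>t. ?xs ! t) ` {..<range_size X n \<omega>}"
    then obtain t where "t < range_size X n \<omega>" "x = ?xs ! t" by auto
    then show "x \<in> ordered_site X n \<omega> ` {1..range_size X n \<omega>}"
      by (intro image_eqI[of _ _ "t + 1"]) (auto simp: ordered_site_def)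
  qed (auto simp: ordered_site_def)
  also have "\<dots> = set ?xs" by (auto simp: set_conv_nth)
  finally show ?thesis by (simp add: set)
qed

lemma ordered_site_strict_mono: "strict_mono_on {1..range_size X n \<omega>} (ordered_site X n \<omega>)"
proof (rule strict_mono_onI)
  fix t t' assume "t \<in> {1..range_size X n \<omega>}" "t' \<in> {1..range_size X n \<omega>}" "t < t'"
  then have "t - 1 < t' - 1" "t' - 1 < length (sorted_list_of_set (visited X n \<omega>))"
    by (auto simp: range_size_def)
  then show "ordered_site X n \<omega> t < ordered_site X n \<omega> t'"
    unfolding ordered_site_def
    by (intro sorted_wrt_nth_less[OF strict_sorted_list_of_set])
qed

lemma range_size_le: "range_size X n \<omega> \<le> n"
  using card_image_le[of "{1..n}" "\<lambda>k. walk X k \<omega>"] by (simp add: range_size_def visited_def)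

lemma (in prob_space) last_exceedance_sum_eq:
  assumes meas: "\<And>i. \<xi> i \<in> borel_measurable M"
  shows "last_exceedance_sum M \<xi> X v r n \<omega>
    = (\<Sum>j=1..range_size X n \<omega> div r + 1.
        1 - joint_cdf M \<xi> (ordered_site X n \<omega> ` block r (range_size X n \<omega>) j) v)"
proof -
  let ?R = "range_size X n \<omega>" and ?s = "ordered_site X n \<omega>"
  let ?L = "\<lambda>j t. prob {\<omega>' \<in> space M. \<xi> (?s t) \<omega>' > v \<and>
      (\<forall>t'\<in>{t + 1..min (j * r) ?R}. \<xi> (?s t') \<omega>' \<le> v)}"
  have inner: "(\<Sum>i \<in> {i \<in> {1..r}. (j - 1) * r + i \<le> ?R}. ?L j ((j - 1) * r + i))
      = 1 - joint_cdf M \<xi> (?s ` block r ?R j) v" if "j \<ge> 1" for j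
  proof -
    have jr: "j * r = (j - 1) * r + r" using that by (cases j) auto
    have "(\<Sum>i \<in> {i \<in> {1..r}. (j - 1) * r + i \<le> ?R}. ?L j ((j - 1) * r + i))
        = (\<Sum>t\<in>block r ?R j. ?L j t)"
      by (rule sum.reindex_bij_witness[of _ "\<lambda>t. t - (j - 1) * r" "\<lambda>i. (j - 1) * r + i"])
        (auto simp: block_def jr)
    also have "\<dots> = 1 - joint_cdf M \<xi> (?s ` block r ?R j) v"
      unfolding block_def joint_cdf_def
      using sum_last_exceedance[of "\<lambda>t. \<xi> (?s t)"] meas by simp
    finally show ?thesis .
  qed
  show ?thesis
    unfolding last_exceedance_sum_def Let_def segment_max_le_iff
    by (rule sum.cong[OF refl], rule inner) simp
qed

section \<open>The limit\<close>

text \<open>The real number \<open>n / k\<close> is at least \<open>2\<close>, so taking the integer part less than halves it, and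
  \<open>R / r \<le> n / r\<close> stays strictly below \<open>2 k\<close>, which leaves room for the incomplete last block.\<close>

lemma block_count_bound:
  fixes k :: int
  assumes "R \<le> n" "0 < k" "2 * k \<le> int n" and r: "r = nat (int n div k)"
  shows "0 < r" "real r \<le> real n / real_of_int k" "real (R div r + 1) \<le> 2 * real_of_int k"
proof -
  have rk: "int r = int n div k" using assms by (simp add: pos_imp_zdiv_nonneg_iff)
  have "2 \<le> int n div k" using zdiv_mono1[OF assms(3,2)] assms(2) by simp
  then show pos: "0 < r" using rk by linarith
  have "int r * k \<le> int n" using pos_mod_sign[OF assms(2), of "int n"] div_mult_mod_eq[of "int n" k]
    unfolding rk by linarith
  then have "real r * real_of_int k \<le> real n" by (metis of_int_le_iff of_int_mult of_int_of_nat_eq)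
  then show "real r \<le> real n / real_of_int k" using assms(2) by (simp add: field_simps)
  have "int n < (int r + 1) * k" using assms(2) rk
    by (metis add.commute div_mult_mod_eq distrib_right mult_1 add_strict_left_mono
        pos_mod_bound mult.commute)
  also have "\<dots> \<le> 2 * int r * k" using assms(2) pos by (intro mult_right_mono) auto
  finally have "int R < 2 * k * int r" using assms(1) by (simp add: mult_ac)
  have "int R div int r < 2 * k"
  proof (rule mult_right_less_imp_less)
    have "int R div int r * int r \<le> int R"
      using pos div_mult_mod_eq[of "int R" "int r"] pos_mod_sign[of "int r" "int R"] by linarith
    also note \<open>int R < 2 * k * int r\<close>
    finally show "int R div int r * int r < 2 * k * int r" .
  qed simp
  then have "int (R div r + 1) \<le> 2 * k" using assms(2) by (simp add: zdiv_int)
  then show "real (R div r + 1) \<le> 2 * real_of_int k" by linarith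
qed

theorem theorem6:
  fixes M :: "'a measure"
    and X :: "nat \<Rightarrow> 'a \<Rightarrow> int"
    and \<xi> :: "int \<Rightarrow> 'a \<Rightarrow> real"
    and N :: "real measure"
    and \<alpha> C\<^sub>1 C\<^sub>2 \<tau> :: real
    and u :: "nat \<Rightarrow> real"
    and a :: "nat \<Rightarrow> nat \<Rightarrow> real"
    and l :: "nat \<Rightarrow> nat"
    and k :: "nat \<Rightarrow> int"
    and r :: "nat \<Rightarrow> nat"
  assumes "prob_space M"
    and steps_indep: "prob_space.indep_vars M (\<lambda>_. count_space UNIV) X {1..}"
    and steps_ident: "\<And>i. i \<ge> 1 \<Longrightarrow>
          distr M (count_space UNIV) (X i) = distr M (count_space UNIV) (X 1)"
    and centered: "integrable M (\<lambda>\<omega>. real_of_int (X 1 \<omega>)) \<Longrightarrow>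
          prob_space.expectation M (\<lambda>\<omega>. real_of_int (X 1 \<omega>)) = 0"
    and index: "0 < \<alpha>" "\<alpha> \<le> 2"
    and stable_law: "real_distribution N" "char N = stable_cf \<alpha> C\<^sub>1 C\<^sub>2"
    and attraction: "\<And>x. (\<lambda>n. \<P>(\<omega> in M. real_of_int (walk X n \<omega>) / real n powr (1 / \<alpha>) \<le> x))
          \<longlonglongrightarrow> cdf N x"
    and scenery_rv: "\<And>i. \<xi> i \<in> borel_measurable M"
    and scenery_stationary: "strictly_stationary M \<xi>"
    and scenery_indep_walk: "indep_elements M
          (PiM {1..} (\<lambda>_. count_space UNIV)) (\<lambda>\<omega>. \<lambda>n\<in>{1..}. walk X n \<omega>)
          (PiM UNIV (\<lambda>_. borel)) (\<lambda>\<omega> (i::int). \<xi> i \<omega>)"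
    and "0 < \<tau>"
    and tail: "(\<lambda>n. real n * \<P>(\<omega> in M. \<xi> 0 \<omega> > u n)) \<longlonglongrightarrow> \<tau>"
    and mixing: "condition_D M \<xi> u a l"
    and blocks: "filterlim k at_top sequentially"
      "(\<lambda>n. (real n)\<^sup>2 / real_of_int (k n) * a n (l n)) \<longlonglongrightarrow> 0"
      "(\<lambda>n. real_of_int (k n) * real (l n)) \<in> o(\<lambda>n. real n)"
    and block_length: "\<And>n. r n = nat (int n div k n)"
  shows "AE \<omega> in M.
    (\<lambda>n. \<P>(\<omega>' in M. visited_max \<xi> X n \<omega> \<omega>' \<le> u n)
        - exp (- last_exceedance_sum M \<xi> X (u n) (r n) n \<omega>)) \<longlonglongrightarrow> 0"
proof (rule AE_I2)
  interpret prob_space M by fact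
  fix \<omega>
  define q where "q n = prob {\<omega>' \<in> space M. \<xi> 0 \<omega>' > u n}" for n
  \<comment> \<open>The bound of \<open>joint_cdf_block_approx\<close> with \<open>2 k\<close> for the number of blocks and \<open>n / k\<close> for
    their length, regrouped into null sequences; \<open>k a\<close> is enlarged to \<open>n\<^sup>2 / k * a\<close>.\<close>
  define \<epsilon> where "\<epsilon> n = 4 * ((real_of_int (k n) * l n) / n * (n * q n)) + 2 * (n\<^sup>2 / k n * a n (l n))
      + 2 * ((n * q n)\<^sup>2 * inverse (real_of_int (k n)))" for n
  have marginal: "prob {\<omega>' \<in> space M. \<xi> i \<omega>' > u n} = q n" for i n
    unfolding q_def by (rule stationary_marginal[OF scenery_stationary scenery_rv])
  have q: "(\<lambda>n. real n * q n) \<longlonglongrightarrow> \<tau>" using tail by (simp add: q_def)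
  have kl: "(\<lambda>n. (real_of_int (k n) * l n) / n) \<longlonglongrightarrow> 0"
    using smalloD_tendsto[OF blocks(3)] by simp
  have k_inv: "(\<lambda>n. inverse (real_of_int (k n))) \<longlonglongrightarrow> 0"
    by (intro tendsto_inverse_0_at_top filterlim_compose[OF filterlim_real_of_int_at_top blocks(1)])
  have "\<epsilon> \<longlonglongrightarrow> 4 * (0 * \<tau>) + 2 * 0 + 2 * (\<tau>\<^sup>2 * 0)"
    unfolding \<epsilon>_def using blocks(2) by (intro tendsto_intros kl q k_inv)
  then have \<epsilon>: "\<epsilon> \<longlonglongrightarrow> 0" by simp
  \<comment> \<open>As \<open>l \<ge> 1\<close>, this gives \<open>2 k \<le> n\<close>.\<close>
  have "\<forall>\<^sub>F n in sequentially. (real_of_int (k n) * l n) / n < 1 / 2"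
    using kl by (rule order_tendstoD) simp
  moreover have "\<forall>\<^sub>F n in sequentially. k n > 0"
    by (rule eventually_compose_filterlim[OF eventually_gt_at_top blocks(1)])
  ultimately have "\<forall>\<^sub>F n in sequentially.
      norm (\<P>(\<omega>' in M. visited_max \<xi> X n \<omega> \<omega>' \<le> u n)
        - exp (- last_exceedance_sum M \<xi> X (u n) (r n) n \<omega>)) \<le> \<epsilon> n"
    using eventually_gt_at_top[of 0]
  proof eventually_elim
    case (elim n)
    let ?R = "range_size X n \<omega>" and ?s = "ordered_site X n \<omega>"
    let ?K = "real (?R div r n + 1)"
    have l: "1 \<le> l n" using mixing by (simp add: condition_D_def Suc_le_eq)
    have k2: "2 * real_of_int (k n) \<le> n"
    proof -
      have "real_of_int (k n) * 1 \<le> real_of_int (k n) * l n" using l elim(2) by (intro mult_left_mono) auto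
      then show ?thesis using elim(1,3) by (simp add: field_simps)
    qed
    then have "2 * k n \<le> int n" by linarith
    note count = block_count_bound[OF range_size_le \<open>0 < k n\<close> this block_length]
    have mix: "\<bar>joint_cdf M \<xi> (I \<union> J) (u n) - joint_cdf M \<xi> I (u n) * joint_cdf M \<xi> J (u n)\<bar>
        \<le> a n (l n)"
      if "finite I" "finite J" "\<And>i j. i \<in> I \<Longrightarrow> j \<in> J \<Longrightarrow> i < j \<and> int (l n) \<le> j - i" for I J
      using mixing_gap[OF mixing] that by blast
    have a: "0 \<le> a n (l n)" using mix[of "{}" "{}"] by (simp add: joint_cdf_empty)
    have q0: "0 \<le> q n" by (simp add: q_def)
    have k0: "0 < real_of_int (k n)" using elim(2) by simp
    have "\<P>(\<omega>' in M. visited_max \<xi> X n \<omega> \<omega>' \<le> u n) = joint_cdf M \<xi> (?s ` {1..?R}) (u n)"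
      by (simp add: joint_cdf_def visited_max_le_iff[OF elim(3)] flip: ordered_site_image)
    then have "norm (\<P>(\<omega>' in M. visited_max \<xi> X n \<omega> \<omega>' \<le> u n)
        - exp (- last_exceedance_sum M \<xi> X (u n) (r n) n \<omega>))
      = \<bar>joint_cdf M \<xi> (?s ` {1..?R}) (u n)
        - exp (- (\<Sum>j=1..?R div r n + 1. 1 - joint_cdf M \<xi> (?s ` block (r n) ?R j) (u n)))\<bar>"
      by (simp only: last_exceedance_sum_eq[OF scenery_rv] real_norm_def)
    also have "\<dots> \<le> ?K * (2 * (real (l n) * q n) + a n (l n) + (real (r n) * q n)\<^sup>2)"
      by (rule joint_cdf_block_approx[OF scenery_rv marginal mix ordered_site_strict_mono count(1)])
    also have "\<dots> \<le> (2 * k n) * (2 * (real (l n) * q n) + a n (l n) + (n / k n * q n)\<^sup>2)"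
      using count a q0 k0
      by (intro mult_mono add_mono power_mono mult_right_mono order_refl) auto
    also have "\<dots> = 4 * ((real_of_int (k n) * l n) / n * (n * q n)) + 2 * (k n * a n (l n))
        + 2 * ((n * q n)\<^sup>2 * inverse (real_of_int (k n)))"
      using k0 elim(3) by (simp add: field_simps power2_eq_square)
    also have "\<dots> \<le> \<epsilon> n"
    proof -
      have "real_of_int (k n) \<le> n" using k2 k0 by linarith
      then have "real_of_int (k n) * k n \<le> real n * n" using k0 by (intro mult_mono) auto
      then have "real_of_int (k n) \<le> n\<^sup>2 / k n" using k0 by (simp add: field_simps power2_eq_square)
      then have "k n * a n (l n) \<le> n\<^sup>2 / k n * a n (l n)" using a by (rule mult_right_mono)
      then show ?thesis by (simp add: \<epsilon>_def)
    qed
    finally show ?case .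
  qed
  then show "(\<lambda>n. \<P>(\<omega>' in M. visited_max \<xi> X n \<omega> \<omega>' \<le> u n)
      - exp (- last_exceedance_sum M \<xi> X (u n) (r n) n \<omega>)) \<longlonglongrightarrow> 0"
    using \<epsilon> by (rule Lim_null_comparison)
qed

end
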